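(* Let $M$ be an ultrahomogeneous structure (in a countable relational language). Let $\bar a\in\mathrm{Age}(M)$, let $B\in\mathrm{Age}(M)$ and let $k\geq 1$ be an integer. Let $\Phi$ be a finite set of formulae with free variables among $\bar x,\bar y$, where $|\bar y|=|\bar a|$. Then $M\to_{\mathrm{ext}(\Phi)}(B)^{\bar a}_k$ if and only if there exists $C\in\mathrm{Age}(M)$ with $C\to_{\mathrm{ext}(\Phi)}(B)^{\bar a}_k$.
   Context: All first-order languages are countable and relational. A structure $M$ is ultrahomogeneous if every isomorphism between finite substructures of $M$ extends to an automorphism of $M$. $\mathrm{Age}(M)$ is the class of finite structures embeddable in $M$. Writing $\bar a\in\mathrm{Age}(M)$ means a structure $A\in\mathrm{Age}(M)$ together with an enumeration $\bar a$ (without repetition) of its elements. For a structure $B$, $\binom{B}{\bar a}=\{f(\bar a): f:A\to B \text{ an embedding}\}$; for structures $B,C$, $\binom{C}{B}$ is the set of substructures of $C$ isomorphic to $B$. A $k$-colouring $\chi:\binom{M}{\bar a}\to k=\{0,\dots,k-1\}$ is externally definable by formulae $\phi_0(\bar x,\bar y),\dots,\phi_{k-1}(\bar x,\bar y)$ (without parameters; $\bar x$ a finite tuple of variables) if there are an elementary extension $N\succeq M$ and a tuple $\bar e$ in $N$ such that for all $\bar a'\in\binom{M}{\bar a}$ and $i<k$: $\chi(\bar a')=i\iff N\models\phi_i(\bar e,\bar a')$. Let $\Gamma=\mathrm{ext}(\Phi,\binom{M}{\bar a},k)$ be the set of all $k$-colourings of $\binom{M}{\bar a}$ externally definable (in some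 elementary extension of $M$) by $k$ formulae from $\Phi$. $M\to_{\mathrm{ext}(\Phi)}(B)^{\bar a}_k$ means: for every $\chi\in\Gamma$ there is $B'\in\binom{M}{B}$ such that $\chi$ is constant on $\binom{B'}{\bar a}$. For $C\in\mathrm{Age}(M)$, $C\to_{\mathrm{ext}(\Phi)}(B)^{\bar a}_k$ means: for every $C'\in\binom{M}{C}$ and every $\chi\in\Gamma$ there is $B'\in\binom{C'}{B}$ such that $\chi$ is constant on $\binom{B'}{\bar a}$. *)

theory Defs
  imports Complex_Main "HOL-Library.FuncSet" "HOL-Library.Countable_Set"
begin

section \<open>Relational first-order logic\<close>

text \<open>
  A relational language is a partial map sending each of its symbols to its arity; the symbols are
  the elements of the domain of the map, so the empty language is included.
\<close>

type_synonym 'r language = "'r \<Rightarrow> nat option"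

text \<open>
  Only the values of \<open>interp\<close> at symbols of the language and at tuples of the right length
  from the carrier are ever used.
\<close>

record ('r, 'a) fo_struct =
  carrier :: "'a set"
  interp :: "'r \<Rightarrow> 'a list \<Rightarrow> bool"

datatype 'r fm =
    Eq nat nat
  | Rel 'r "nat list"
  | Neg "'r fm"
  | And "'r fm" "'r fm"
  | Ex nat "'r fm"

primrec fv :: "'r fm \<Rightarrow> nat set" where
  "fv (Eq i j) = {i, j}"
| "fv (Rel r vs) = set vs"
| "fv (Neg p) = fv p"
| "fv (And p q) = fv p \<union> fv q"
| "fv (Ex i p) = fv p - {i}"

primrec wf_fm :: "'r language \<Rightarrow> 'r fm \<Rightarrow> bool" where
  "wf_fm L (Eq i j) \<longleftrightarrow> True"
| "wf_fm L (Rel r vs) \<longleftrightarrow> L r = Some (length vs)"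
| "wf_fm L (Neg p) \<longleftrightarrow> wf_fm L p"
| "wf_fm L (And p q) \<longleftrightarrow> wf_fm L p \<and> wf_fm L q"
| "wf_fm L (Ex i p) \<longleftrightarrow> wf_fm L p"

primrec sat :: "('r, 'a) fo_struct \<Rightarrow> (nat \<Rightarrow> 'a) \<Rightarrow> 'r fm \<Rightarrow> bool" where
  "sat M v (Eq i j) \<longleftrightarrow> v i = v j"
| "sat M v (Rel r vs) \<longleftrightarrow> interp M r (map v vs)"
| "sat M v (Neg p) \<longleftrightarrow> \<not> sat M v p"
| "sat M v (And p q) \<longleftrightarrow> sat M v p \<and> sat M v q"
| "sat M v (Ex i p) \<longleftrightarrow> (\<exists>x \<in> carrier M. sat M (v(i := x)) p)"

text \<open>The assignment sending the variables \<open>vs\<close> to the elements \<open>as\<close>, in this order.\<close>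

definition assign :: "nat list \<Rightarrow> 'a list \<Rightarrow> nat \<Rightarrow> 'a" where
  "assign vs as = (\<lambda>i. the (map_of (zip vs as) i))"

section \<open>Embeddings, ages, ultrahomogeneity\<close>

definition embedding ::
    "'r language \<Rightarrow> ('r, 'a) fo_struct \<Rightarrow> ('r, 'b) fo_struct \<Rightarrow> ('a \<Rightarrow> 'b) \<Rightarrow> bool" where
  "embedding L A B f \<longleftrightarrow>
     f \<in> carrier A \<rightarrow> carrier B \<and> inj_on f (carrier A) \<and>
     (\<forall>r as. L r = Some (length as) \<and> set as \<subseteq> carrier A \<longrightarrow>
        (interp A r as \<longleftrightarrow> interp B r (map f as)))"

definition isomorphism ::
    "'r language \<Rightarrow> ('r, 'a) fo_struct \<Rightarrow> ('r, 'b) fo_struct \<Rightarrow> ('a \<Rightarrow> 'b) \<Rightarrow> bool" where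
  "isomorphism L A B f \<longleftrightarrow> embedding L A B f \<and> f ` carrier A = carrier B"

definition substr :: "('r, 'a) fo_struct \<Rightarrow> 'a set \<Rightarrow> ('r, 'a) fo_struct" where
  "substr M S = M\<lparr>carrier := S\<rparr>"

definition ultrahomogeneous :: "'r language \<Rightarrow> ('r, 'a) fo_struct \<Rightarrow> bool" where
  "ultrahomogeneous L M \<longleftrightarrow>
     (\<forall>S T f. finite S \<and> finite T \<and> S \<subseteq> carrier M \<and> T \<subseteq> carrier M \<and>
        isomorphism L (substr M S) (substr M T) f \<longrightarrow>
        (\<exists>g. isomorphism L M M g \<and> (\<forall>x \<in> S. g x = f x)))"

text \<open>
  The class \<open>Age(M)\<close>, as far as structures with elements of a type \<open>'b\<close> are concerned. For an infinite
  type \<open>'b\<close>, such as \<^typ>\<open>nat\<close>, this contains every member of the age up to isomorphism.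
\<close>

definition Age :: "'r language \<Rightarrow> ('r, 'a) fo_struct \<Rightarrow> ('r, 'b) fo_struct set" where
  "Age L M = {A. finite (carrier A) \<and> (\<exists>f. embedding L A M f)}"

definition enumerates :: "'a list \<Rightarrow> ('r, 'a) fo_struct \<Rightarrow> bool" where
  "enumerates as A \<longleftrightarrow> distinct as \<and> set as = carrier A"

text \<open>\<open>tuple_copies L A as B\<close> is $\binom{B}{\bar a}$ for \<open>A\<close> enumerated by \<open>as\<close>.\<close>

definition tuple_copies ::
    "'r language \<Rightarrow> ('r, 'a) fo_struct \<Rightarrow> 'a list \<Rightarrow> ('r, 'b) fo_struct \<Rightarrow> 'b list set" where
  "tuple_copies L A as B = {map f as | f. embedding L A B f}"

text \<open>\<open>copies L B C\<close> is $\binom{C}{B}$.\<close>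

definition copies ::
    "'r language \<Rightarrow> ('r, 'b) fo_struct \<Rightarrow> ('r, 'c) fo_struct \<Rightarrow> ('r, 'c) fo_struct set" where
  "copies L B C = {substr C S | S. S \<subseteq> carrier C \<and> (\<exists>f. isomorphism L B (substr C S) f)}"

section \<open>Externally definable colourings\<close>

text \<open>
  An elementary extension of \<open>M\<close> is given by an elementary embedding \<open>h\<close> of \<open>M\<close> into some \<open>N\<close>,
  identifying \<open>M\<close> with its image. The condition on \<open>v\<close> restricts only the values at free variables,
  so that sentences are preserved even if \<open>M\<close> is empty.
\<close>

definition elementary_embedding ::
    "'r language \<Rightarrow> ('r, 'a) fo_struct \<Rightarrow> ('r, 'b) fo_struct \<Rightarrow> ('a \<Rightarrow> 'b) \<Rightarrow> bool" where
  "elementary_embedding L M N h \<longleftrightarrow>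
     h \<in> carrier M \<rightarrow> carrier N \<and>
     (\<forall>p v. wf_fm L p \<and> v ` fv p \<subseteq> carrier M \<longrightarrow> (sat M v p \<longleftrightarrow> sat N (h \<circ> v) p))"

text \<open>
  The set of \<open>k\<close>-colourings of $\binom{M}{\bar a}$ that are externally definable by \<open>k\<close> formulae from
  \<open>Phi\<close>, where the elementary extensions have elements of type \<open>'n\<close>. The tuples of variables
  $\bar x$, $\bar y$ are \<open>xs\<close>, \<open>ys\<close>.
\<close>

definition ext_colourings_in ::
    "'n itself \<Rightarrow> 'r language \<Rightarrow> ('r, 'm) fo_struct \<Rightarrow> nat list \<Rightarrow> nat list \<Rightarrow> 'r fm set \<Rightarrow>
     ('r, 'a) fo_struct \<Rightarrow> 'a list \<Rightarrow> nat \<Rightarrow> ('m list \<Rightarrow> nat) set" where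
  "ext_colourings_in _ L M xs ys Phi A as k =
     {\<chi> \<in> tuple_copies L A as M \<rightarrow>\<^sub>E {..<k}.
        \<exists>(N :: ('r, 'n) fo_struct) h es \<phi>.
          elementary_embedding L M N h \<and>
          length es = length xs \<and> set es \<subseteq> carrier N \<and>
          (\<forall>i<k. \<phi> i \<in> Phi) \<and>
          (\<forall>as' \<in> tuple_copies L A as M. \<forall>i<k.
             \<chi> as' = i \<longleftrightarrow> sat N (assign (xs @ ys) (es @ map h as')) (\<phi> i))}"

text \<open>
  HOL cannot quantify over the type \<open>'n\<close> inside a definition. A universe with as many elements as \<open>M\<close>
  plus countably many is enough for a countable language: the lemma \<open>ext_colourings_universal\<close> below
  shows, by the downward Loewenheim--Skolem argument, that elementary extensions with elements of
  any other type define no further colourings.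
\<close>

definition ext_colourings ::
    "'r language \<Rightarrow> ('r, 'm) fo_struct \<Rightarrow> nat list \<Rightarrow> nat list \<Rightarrow> 'r fm set \<Rightarrow>
     ('r, 'a) fo_struct \<Rightarrow> 'a list \<Rightarrow> nat \<Rightarrow> ('m list \<Rightarrow> nat) set" where
  "ext_colourings = ext_colourings_in TYPE('m + nat)"

definition monochromatic :: "('b \<Rightarrow> nat) \<Rightarrow> 'b set \<Rightarrow> bool" where
  "monochromatic \<chi> X \<longleftrightarrow> (\<forall>s \<in> X. \<forall>t \<in> X. \<chi> s = \<chi> t)"

text \<open>$M \to_{\mathrm{ext}(\Phi)} (B)^{\bar a}_k$\<close>

definition ext_arrow_structure ::
    "'r language \<Rightarrow> ('r, 'm) fo_struct \<Rightarrow> nat list \<Rightarrow> nat list \<Rightarrow> 'r fm set \<Rightarrow>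
     ('r, 'b) fo_struct \<Rightarrow> ('r, 'a) fo_struct \<Rightarrow> 'a list \<Rightarrow> nat \<Rightarrow> bool" where
  "ext_arrow_structure L M xs ys Phi B A as k \<longleftrightarrow>
     (\<forall>\<chi> \<in> ext_colourings L M xs ys Phi A as k.
        \<exists>B' \<in> copies L B M. monochromatic \<chi> (tuple_copies L A as B'))"

text \<open>$C \to_{\mathrm{ext}(\Phi)} (B)^{\bar a}_k$ for \<open>C\<close> in the age of \<open>M\<close>\<close>

definition ext_arrow_age ::
    "'r language \<Rightarrow> ('r, 'm) fo_struct \<Rightarrow> nat list \<Rightarrow> nat list \<Rightarrow> 'r fm set \<Rightarrow>
     ('r, 'c) fo_struct \<Rightarrow> ('r, 'b) fo_struct \<Rightarrow> ('r, 'a) fo_struct \<Rightarrow> 'a list \<Rightarrow> nat \<Rightarrow> bool" where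
  "ext_arrow_age L M xs ys Phi C B A as k \<longleftrightarrow>
     (\<forall>C' \<in> copies L C M. \<forall>\<chi> \<in> ext_colourings L M xs ys Phi A as k.
        \<exists>B' \<in> copies L B C'. monochromatic \<chi> (tuple_copies L A as B'))"

section \<open>Independence of the universe of the elementary extensions\<close>

lemma assign_map:
  assumes "length vs = length as" "i \<in> set vs"
  shows "assign vs (map h as) i = h (assign vs as i)"
  using assms
  by (induction vs as rule: list_induct2) (auto simp: assign_def)

lemma assign_in:
  assumes "length vs = length as" "i \<in> set vs"
  shows "assign vs as i \<in> set as"
  using assms
  by (induction vs as rule: list_induct2) (auto simp: assign_def)

lemma assign_self: "i \<in> set vs \<Longrightarrow> assign vs (map v vs) i = v i"
  by (induction vs) (auto simp: assign_def)

lemma finite_fv: "finite (fv p)"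
  by (induction p) auto

lemma sat_cong: "(\<And>i. i \<in> fv p \<Longrightarrow> v i = w i) \<Longrightarrow> sat M v p \<longleftrightarrow> sat M w p"
proof (induction p arbitrary: v w)
  case (Rel r vs)
  then have "map v vs = map w vs" by simp
  then show ?case by (simp only: sat.simps)
next
  case (Neg p)
  then show ?case by (metis fv.simps(3) sat.simps(3))
next
  case (And p q)
  then show ?case by (metis UnCI fv.simps(4) sat.simps(4))
next
  case (Ex i p)
  have "sat M (v(i := x)) p \<longleftrightarrow> sat M (w(i := x)) p" for x
    by (rule Ex.IH) (use Ex.prems in auto)
  then show ?case by simp
qed simp

instance fm :: (countable) countable
  by countable_datatype

lemma wf_fm_set: "wf_fm L p \<Longrightarrow> set_fm p \<subseteq> dom L"
  by (induction p) auto

lemma countable_wf_fm: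
  assumes "countable (dom L)"
  shows "countable {p. wf_fm L p}"
proof -
  have "inj_on (map_fm (to_nat_on (dom L))) {p. wf_fm L p}"
  proof (rule inj_onI)
    fix p q assume pq: "p \<in> {p. wf_fm L p}" "q \<in> {p. wf_fm L p}"
      and eq: "map_fm (to_nat_on (dom L)) p = map_fm (to_nat_on (dom L)) q"
    show "p = q"
    proof (rule fm.inj_map_strong[OF _ eq])
      fix z z' assume "z \<in> set_fm p" "z' \<in> set_fm q"
        "to_nat_on (dom L) z = to_nat_on (dom L) z'"
      then show "z = z'"
        using wf_fm_set[of L p] wf_fm_set[of L q] pq
        by (intro inj_onD[OF inj_on_to_nat_on[OF assms]]) auto
    qed
  qed
  then show ?thesis
    by (rule countable_image_inj_on[rotated]) simp
qed

lemma inj_code_lists: "\<exists>E :: nat \<times> ('m + nat) list \<Rightarrow> 'm + nat. inj E"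
proof -
  let ?U = "UNIV :: ('m + nat) set"
  have inf: "infinite ?U"
    by (metis finite_Plus_UNIV_iff infinite_UNIV_nat)
  obtain p where p: "bij_betw p (?U \<times> ?U) ?U"
    using card_of_ordIso[THEN iffD2, OF card_of_Times_same_infinite[OF inf]] by blast
  have pe: "p (a, b) = p (c, d) \<longleftrightarrow> a = c \<and> b = d" for a b c d
    using inj_on_eq_iff[OF bij_betw_imp_inj_on[OF p], of "(a, b)" "(c, d)"] by simp
  define F where "F = (\<lambda>xs. foldr (\<lambda>x y. p (x, y)) xs (Inr 0))"
  have F: "length xs = length ys \<Longrightarrow> F xs = F ys \<Longrightarrow> xs = ys" for xs ys
    by (induction xs ys rule: list_induct2) (auto simp: F_def pe)
  define E where "E = (\<lambda>(n :: nat, xs). p (Inr n, p (Inr (length xs), F xs)))"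
  have "inj E"
    unfolding E_def by (rule injI) (auto simp: pe intro: F)
  then show ?thesis by blast
qed

text \<open>
  A set of at most \<open>|'m| + \<aleph>\<^sub>0\<close> elements is contained in an elementary substructure
  of at most this size.
\<close>

lemma skolem_hull:
  fixes N :: "('r, 'n) fo_struct" and f0 :: "'m + nat \<Rightarrow> 'n"
  assumes L: "countable (dom L)" and X: "X \<subseteq> range f0" "X \<subseteq> carrier N"
  obtains K and f :: "'m + nat \<Rightarrow> 'n" where "X \<subseteq> K" "K \<subseteq> carrier N" "K \<subseteq> range f"
    "\<And>p v. wf_fm L p \<Longrightarrow> v ` fv p \<subseteq> K \<Longrightarrow> sat (substr N K) v p \<longleftrightarrow> sat N v p"
proof -
  obtain E :: "nat \<times> ('m + nat) list \<Rightarrow> 'm + nat" where E: "inj E"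
    using inj_code_lists by blast
  define T where "T = {p. wf_fm L p} \<times> (UNIV :: nat set)"
  have T: "countable T" "T \<noteq> {}"
    using countable_wf_fm[OF L] wf_fm.simps(1)[of L 0 0]
    by (auto simp: T_def simp del: wf_fm.simps)
  define wit where "wit = (\<lambda>(p :: 'r fm, i) l. SOME x. x \<in> carrier N \<and>
     sat N ((assign (sorted_list_of_set (fv p - {i})) l)(i := x)) p)"
  define G where "G = (\<lambda>m l. case m of 0 \<Rightarrow> hd l | Suc m \<Rightarrow> wit (from_nat_into T m) l)"
  define step where "step = (\<lambda>K. {G m l | m l. set l \<subseteq> K} \<inter> carrier N)"
  define H where "H = (\<lambda>n. (step ^^ n) X)"
  have H0: "H 0 = X" and HS: "H (Suc n) = step (H n)" for n
    by (auto simp: H_def)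
  have HN: "H n \<subseteq> carrier N" for n
    by (cases n) (use X in \<open>auto simp: H0 HS step_def\<close>)
  have Hmono1: "H n \<subseteq> H (Suc n)" for n
  proof
    fix x assume x: "x \<in> H n"
    have "x = G 0 [x]" by (simp add: G_def)
    moreover have "set [x] \<subseteq> H n" using x by simp
    ultimately show "x \<in> H (Suc n)"
      using HN[of n] x unfolding HS step_def by blast
  qed
  have Hmono: "H m \<subseteq> H n" if "m \<le> n" for m n
    by (rule lift_Suc_mono_le[of H, OF Hmono1 that])
  have "\<exists>f :: 'm + nat \<Rightarrow> 'n. H n \<subseteq> range f" for n
  proof (induction n)
    case 0
    then show ?case using X H0 by blast
  next
    case (Suc n)
    then obtain f :: "'m + nat \<Rightarrow> 'n" where f: "H n \<subseteq> range f" by blast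
    have "H (Suc n) \<subseteq> range (\<lambda>u. case inv E u of (m, l) \<Rightarrow> G m (map f l))"
    proof
      fix x assume "x \<in> H (Suc n)"
      then obtain m l where ml: "x = G m l" "set l \<subseteq> H n"
        by (auto simp: HS step_def)
      have "map f (map (inv f) l) = l"
        using ml(2) f by (auto simp: f_inv_into_f subset_iff intro!: map_idI)
      then have "x = (case inv E (E (m, map (inv f) l)) of (m, l) \<Rightarrow> G m (map f l))"
        using ml(1) E by simp
      then show "x \<in> range (\<lambda>u. case inv E u of (m, l) \<Rightarrow> G m (map f l))" by blast
    qed
    then show ?case by blast
  qed
  then obtain fs :: "nat \<Rightarrow> 'm + nat \<Rightarrow> 'n" where fs: "\<And>n. H n \<subseteq> range (fs n)"
    by metis
  define K where "K = (\<Union>n. H n)"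
  have K1: "X \<subseteq> K" "K \<subseteq> carrier N"
    using HN H0 by (auto simp: K_def)
  have K2: "K \<subseteq> range (\<lambda>u. case inv E u of (m, l) \<Rightarrow> fs m (hd l))"
  proof
    fix x assume "x \<in> K"
    then obtain n u where "x = fs n u" using fs unfolding K_def by blast
    then have "x = (case inv E (E (n, [u])) of (m, l) \<Rightarrow> fs m (hd l))"
      using E by simp
    then show "x \<in> range (\<lambda>u. case inv E u of (m, l) \<Rightarrow> fs m (hd l))" by blast
  qed
  have fin: "\<exists>n. Y \<subseteq> H n" if "finite Y" "Y \<subseteq> K" for Y
    using that
  proof (induction Y rule: finite_induct)
    case (insert y Y)
    then obtain n m where "Y \<subseteq> H n" "y \<in> H m" by (auto simp: K_def)
    then have "insert y Y \<subseteq> H (max n m)"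
      using Hmono[of n "max n m"] Hmono[of m "max n m"] by auto
    then show ?case by blast
  qed simp
  have witness: "\<exists>y \<in> K. sat N (v(i := y)) p"
    if p: "wf_fm L p" and v: "v ` (fv p - {i}) \<subseteq> K"
      and x: "x \<in> carrier N" "sat N (v(i := x)) p" for p v i x
  proof -
    define vs where "vs = sorted_list_of_set (fv p - {i})"
    have vs: "set vs = fv p - {i}" using finite_fv[of p] by (simp add: vs_def)
    have eq: "sat N ((assign vs (map v vs))(i := z)) p \<longleftrightarrow> sat N (v(i := z)) p" for z
      by (rule sat_cong) (auto simp: assign_self vs)
    define y where "y = wit (p, i) (map v vs)"
    have y: "y \<in> carrier N \<and> sat N (v(i := y)) p"
      using someI[of "\<lambda>x. x \<in> carrier N \<and> sat N ((assign vs (map v vs))(i := x)) p" x] x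
      by (simp add: y_def wit_def vs_def[symmetric] eq)
    obtain n where n: "set (map v vs) \<subseteq> H n"
      using fin[of "set (map v vs)"] v unfolding set_map vs by (metis finite_set finite_imageI vs)
    obtain m where "from_nat_into T m = (p, i)"
      using from_nat_into_surj[OF T(1), of "(p, i)"] p by (auto simp: T_def)
    then have "y = G (Suc m) (map v vs)" by (simp add: G_def y_def)
    then have "y \<in> H (Suc n)" using n y unfolding HS step_def by blast
    then show ?thesis using y by (auto simp: K_def)
  qed
  have "sat (substr N K) v p \<longleftrightarrow> sat N v p" if "wf_fm L p" "v ` fv p \<subseteq> K" for p v
    using that
  proof (induction p arbitrary: v)
    case (Ex i p)
    have IH: "sat (substr N K) (v(i := x)) p \<longleftrightarrow> sat N (v(i := x)) p" if "x \<in> K" for x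
      by (rule Ex.IH) (use Ex.prems that in auto)
    show ?case
      using IH witness[of p v i] Ex.prems K1(2) by (auto simp: substr_def)
  qed (auto simp: substr_def image_Un)
  then show ?thesis using that K1 K2 by blast
qed

lemma sat_isomorphism:
  assumes f: "isomorphism L A B f"
  shows "wf_fm L p \<Longrightarrow> v ` fv p \<subseteq> carrier A \<Longrightarrow> sat A v p \<longleftrightarrow> sat B (f \<circ> v) p"
proof (induction p arbitrary: v)
  case (Eq i j)
  then show ?case using f by (auto simp: isomorphism_def embedding_def dest: inj_onD)
next
  case (Rel r vs)
  then have "interp A r (map v vs) \<longleftrightarrow> interp B r (map f (map v vs))"
    using f unfolding isomorphism_def embedding_def by auto
  then show ?case by (simp add: comp_def)
next
  case (Ex i p)
  have "sat A (v(i := x)) p \<longleftrightarrow> sat B ((f \<circ> v)(i := f x)) p" if "x \<in> carrier A" for x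
  proof -
    have "(f \<circ> v)(i := f x) = f \<circ> v(i := x)" by auto
    moreover have "sat A (v(i := x)) p \<longleftrightarrow> sat B (f \<circ> v(i := x)) p"
      by (rule Ex.IH) (use Ex.prems that in auto)
    ultimately show ?thesis by simp
  qed
  moreover have "carrier B = f ` carrier A" using f by (simp add: isomorphism_def)
  ultimately show ?case by (simp only: sat.simps bex_simps) blast
qed (auto simp: image_Un)

lemma ext_colourings_universal:
  fixes M :: "('r, 'm) fo_struct"
  assumes L: "countable (dom L)"
    and Phi: "\<And>p. p \<in> Phi \<Longrightarrow> wf_fm L p \<and> fv p \<subseteq> set xs \<union> set ys"
    and len: "length ys = length as"
    and A: "set as \<subseteq> carrier A"
  shows "ext_colourings_in TYPE('n) L M xs ys Phi A as k \<subseteq> ext_colourings L M xs ys Phi A as k"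
proof
  fix \<chi> assume "\<chi> \<in> ext_colourings_in TYPE('n) L M xs ys Phi A as k"
  then obtain N :: "('r, 'n) fo_struct" and h es \<phi> where
    \<chi>: "\<chi> \<in> tuple_copies L A as M \<rightarrow>\<^sub>E {..<k}" and
    h: "elementary_embedding L M N h" and
    es: "length es = length xs" "set es \<subseteq> carrier N" and
    \<phi>: "\<forall>i<k. \<phi> i \<in> Phi" and
    def: "\<forall>as' \<in> tuple_copies L A as M. \<forall>i<k.
             \<chi> as' = i \<longleftrightarrow> sat N (assign (xs @ ys) (es @ map h as')) (\<phi> i)"
    unfolding ext_colourings_in_def by blast
  have hM: "h ` carrier M \<subseteq> carrier N"
    using h by (auto simp: elementary_embedding_def)
  define f0 where "f0 = (\<lambda>u. case u of Inl x \<Rightarrow> h x | Inr n \<Rightarrow> es ! n)"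
  have "h ` carrier M \<union> set es \<subseteq> range f0"
  proof -
    have "h x = f0 (Inl x)" "es ! n = f0 (Inr n)" for x n by (auto simp: f0_def)
    then show ?thesis by (auto simp: in_set_conv_nth)
  qed
  then obtain K and f :: "'m + nat \<Rightarrow> 'n" where
    K: "h ` carrier M \<union> set es \<subseteq> K" "K \<subseteq> carrier N" "K \<subseteq> range f" and
    Ksat: "\<And>p v. wf_fm L p \<Longrightarrow> v ` fv p \<subseteq> K \<Longrightarrow> sat (substr N K) v p \<longleftrightarrow> sat N v p"
    using skolem_hull[OF L, of "h ` carrier M \<union> set es" f0 N] hM es(2)
    by (metis Un_least)
  define g where "g = inv f"
  have fg: "f (g x) = x" if "x \<in> K" for x
    using K(3) that by (auto simp: g_def f_inv_into_f subset_iff)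
  define N' :: "('r, 'm + nat) fo_struct" where
    "N' = \<lparr>carrier = g ` K, interp = (\<lambda>r us. interp N r (map f us))\<rparr>"
  have "map f (map g us) = us" if "set us \<subseteq> K" for us
    using that fg by (auto intro!: map_idI)
  then have iso: "isomorphism L (substr N K) N' g"
    by (auto simp: isomorphism_def embedding_def N'_def substr_def simp del: map_map
        intro!: inj_on_inverseI[of K f g] fg)
  have tr: "sat N v p \<longleftrightarrow> sat N' (g \<circ> v) p" if "wf_fm L p" "v ` fv p \<subseteq> K" for p v
    using sat_isomorphism[OF iso that(1), of v] Ksat[OF that] that(2)
    by (simp add: substr_def)
  have emb: "elementary_embedding L M N' (g \<circ> h)"
    unfolding elementary_embedding_def
  proof (intro conjI allI impI)
    show "g \<circ> h \<in> carrier M \<rightarrow> carrier N'" using K(1) by (auto simp: N'_def)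
  next
    fix p v assume pv: "wf_fm L p \<and> v ` fv p \<subseteq> carrier M"
    then have "sat M v p \<longleftrightarrow> sat N (h \<circ> v) p"
      using h by (simp add: elementary_embedding_def)
    also have "\<dots> \<longleftrightarrow> sat N' (g \<circ> (h \<circ> v)) p"
      using pv K(1) by (intro tr) auto
    finally show "sat M v p \<longleftrightarrow> sat N' (g \<circ> h \<circ> v) p" by (simp add: comp_assoc)
  qed
  have "sat N (assign (xs @ ys) (es @ map h as')) (\<phi> i) \<longleftrightarrow>
        sat N' (assign (xs @ ys) (map g es @ map (g \<circ> h) as')) (\<phi> i)"
    if as': "as' \<in> tuple_copies L A as M" and i: "i < k" for as' i
  proof -
    have le: "length (xs @ ys) = length (es @ map h as')"
      using as' es(1) len by (auto simp: tuple_copies_def)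
    have set: "set (es @ map h as') \<subseteq> K"
      using as' K(1) A by (fastforce simp: tuple_copies_def embedding_def)
    have fvi: "fv (\<phi> i) \<subseteq> set (xs @ ys)" "wf_fm L (\<phi> i)"
      using Phi \<phi> i by auto
    have "sat N (assign (xs @ ys) (es @ map h as')) (\<phi> i) \<longleftrightarrow>
          sat N' (g \<circ> assign (xs @ ys) (es @ map h as')) (\<phi> i)"
      using assign_in[OF le] set fvi by (intro tr) blast+
    also have "\<dots> \<longleftrightarrow> sat N' (assign (xs @ ys) (map g (es @ map h as'))) (\<phi> i)"
    proof (rule sat_cong)
      fix j assume "j \<in> fv (\<phi> i)"
      then have j: "j \<in> set (xs @ ys)" using fvi by blast
      show "(g \<circ> assign (xs @ ys) (es @ map h as')) j =
            assign (xs @ ys) (map g (es @ map h as')) j"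
        unfolding assign_map[OF le j] by (simp only: comp_apply)
    qed
    finally show ?thesis by simp
  qed
  then have "\<forall>as' \<in> tuple_copies L A as M. \<forall>i<k.
     \<chi> as' = i \<longleftrightarrow> sat N' (assign (xs @ ys) (map g es @ map (g \<circ> h) as')) (\<phi> i)"
    using def by blast
  moreover have "set (map g es) \<subseteq> carrier N'" "length (map g es) = length xs"
    using K(1) es(1) by (auto simp: N'_def)
  ultimately show "\<chi> \<in> ext_colourings L M xs ys Phi A as k"
    unfolding ext_colourings_def ext_colourings_in_def using \<chi> emb \<phi> by blast
qed

end

theory Submission
  imports Defs
begin

text \<open>
  If no \<open>C\<close> in the age works then, by ultrahomogeneity, every finite \<open>S \<subseteq> M\<close> carries a colouring
  \<open>\<chi>\<^sub>S\<close> in \<open>\<Gamma>\<close> without a monochromatic copy of \<open>B\<close> inside \<open>S\<close>: an automorphism of \<open>M\<close> moves a bad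
  copy of \<open>S\<close> onto \<open>S\<close>, and \<open>\<Gamma>\<close> is invariant under automorphisms. Since \<open>\<Phi>\<close> is finite, \<open>\<Gamma>\<close> is
  closed under pointwise limits along an ultrafilter \<open>U\<close>: the \<open>U\<close>-limit of the \<open>\<chi>\<^sub>S\<close> is defined in
  the ultraproduct of the elementary extensions defining the \<open>\<chi>\<^sub>S\<close>. If \<open>U\<close> refines the filter of
  cones of finite subsets of \<open>M\<close>, the limit has no monochromatic copy of \<open>B\<close> in \<open>M\<close>.
\<close>

section \<open>Ultrafilters\<close>

definition ultrafilter :: "'i filter \<Rightarrow> bool" where
  "ultrafilter U \<longleftrightarrow> U \<noteq> bot \<and> (\<forall>P. eventually P U \<or> eventually (\<lambda>i. \<not> P i) U)"

text \<open>Zorn's lemma gives a minimal proper filter below \<open>F\<close>. The order is reversed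
  because finer filters are smaller: an upper bound of a chain is its infimum.\<close>

lemma ex_ultrafilter:
  fixes F :: "'i filter"
  assumes "F \<noteq> bot"
  obtains U where "ultrafilter U" "U \<le> F"
proof -
  define \<A> where "\<A> = {G. G \<noteq> bot \<and> G \<le> F}"
  have "\<exists>U\<in>\<A>. \<forall>G\<in>\<A>. G \<le> U \<longrightarrow> G = U"
  proof (rule predicate_Zorn)
    show "partial_order_on \<A> (relation_of (\<lambda>G H. H \<le> G) \<A>)"
      by (rule partial_order_on_relation_ofI) auto
  next
    fix C assume C: "C \<in> Chains (relation_of (\<lambda>G H. H \<le> G) \<A>)"
    have CA: "C \<subseteq> \<A>"
      using C by (auto simp: Chains_def relation_of_def)
    have tot: "G \<le> H \<or> H \<le> G" if "G \<in> C" "H \<in> C" for G H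
      using C that by (auto simp: Chains_def relation_of_def)
    show "\<exists>U\<in>\<A>. \<forall>G\<in>C. U \<le> G"
    proof (cases "C = {}")
      case True
      then show ?thesis using assms by (auto simp: \<A>_def)
    next
      case False
      \<comment> \<open>A chain is directed, so what holds eventually along its infimum already does
        so along one of its members; properness is inherited.\<close>
      have "eventually P (Inf C) \<longleftrightarrow> (\<exists>G\<in>C. eventually P G)" for P
        by (rule eventually_Inf_base[OF False])
          (use tot in \<open>metis inf.orderE inf.orderI inf.commute order_refl\<close>)
      then have "Inf C \<noteq> bot"
        using CA by (auto simp: \<A>_def trivial_limit_def)
      moreover have "Inf C \<le> F"
        using False CA by (auto simp: \<A>_def intro: Inf_lower2)
      ultimately show ?thesis
        by (auto simp: \<A>_def intro: Inf_lower)
    qed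
  qed
  then obtain U where U: "U \<noteq> bot" "U \<le> F"
    and min: "\<And>G. G \<noteq> bot \<Longrightarrow> G \<le> U \<Longrightarrow> G = U"
    unfolding \<A>_def by (metis (mono_tags, lifting) mem_Collect_eq order_trans)
  \<comment> \<open>Restricting \<open>U\<close> to the set where \<open>P\<close> holds gives
    either the improper filter, so the complement belongs to \<open>U\<close>, or, by minimality,
    \<open>U\<close> itself.\<close>
  have "eventually P U \<or> eventually (\<lambda>i. \<not> P i) U" for P
  proof (cases "inf U (principal {i. P i}) = bot")
    case True
    then have "eventually (\<lambda>i. False) (inf U (principal {i. P i}))" by simp
    then show ?thesis by (simp add: eventually_inf_principal)
  next
    case False
    then have "inf U (principal {i. P i}) = U" by (rule min) simp
    moreover have "eventually P (inf U (principal {i. P i}))"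
      by (simp add: eventually_inf_principal)
    ultimately show ?thesis by simp
  qed
  with U show ?thesis using that by (auto simp: ultrafilter_def)
qed

lemma ultrafilter_neq_bot: "ultrafilter U \<Longrightarrow> U \<noteq> bot"
  by (simp add: ultrafilter_def)

lemma ultrafilter_eventually_not:
  assumes "ultrafilter U"
  shows "eventually (\<lambda>i. \<not> P i) U \<longleftrightarrow> \<not> eventually P U"
proof
  assume "eventually (\<lambda>i. \<not> P i) U"
  then show "\<not> eventually P U"
    using ultrafilter_neq_bot[OF assms] eventually_elim2[of "\<lambda>i. \<not> P i" U P "\<lambda>_. False"]
    by (auto simp: trivial_limit_def)
qed (use assms in \<open>auto simp: ultrafilter_def\<close>)

text \<open>If every value in \<open>F\<close> were avoided almost everywhere, then,
  \<open>F\<close> being finite, all of them would be avoided at a common index. This is applied to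
  colours and to defining formulae.\<close>

lemma ultrafilter_finite_limit:
  assumes "ultrafilter U" "finite F" "\<And>i. f i \<in> F"
  obtains c where "c \<in> F" "eventually (\<lambda>i. f i = c) U"
proof -
  have "\<exists>c\<in>F. eventually (\<lambda>i. f i = c) U"
  proof (rule ccontr)
    assume "\<not> ?thesis"
    then have "\<forall>c\<in>F. eventually (\<lambda>i. f i \<noteq> c) U"
      using assms(1) by (simp add: ultrafilter_eventually_not)
    then have "eventually (\<lambda>i. \<forall>c\<in>F. f i \<noteq> c) U"
      by (rule eventually_ball_finite[OF assms(2)])
    then have "eventually (\<lambda>i. False) U"
      by (rule eventually_mono) (use assms(3) in blast)
    then show False
      using ultrafilter_neq_bot[OF assms(1)] by (simp add: trivial_limit_def)
  qed
  then show ?thesis using that by blast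
qed

section \<open>Ultraproducts\<close>

text \<open>The class is formed among all functions on the index set, including those that leave the
  carriers, so it does not depend on the factors.\<close>

definition uclass :: "'i filter \<Rightarrow> ('i \<Rightarrow> 'n) \<Rightarrow> ('i \<Rightarrow> 'n) set" where
  "uclass U f = {g. eventually (\<lambda>i. g i = f i) U}"

text \<open>
  Membership in the factors is required only almost everywhere, because some factors may be empty.
\<close>

definition ultraproduct ::
    "'i filter \<Rightarrow> ('i \<Rightarrow> ('r, 'n) fo_struct) \<Rightarrow> ('r, ('i \<Rightarrow> 'n) set) fo_struct" where
  "ultraproduct U N =
     \<lparr>carrier = {uclass U f | f. eventually (\<lambda>i. f i \<in> carrier (N i)) U},
      interp = (\<lambda>r Xs. eventually (\<lambda>i. interp (N i) r (map (\<lambda>X. (SOME f. f \<in> X) i) Xs)) U)\<rparr>"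

lemma uclass_eq_iff: "uclass U f = uclass U g \<longleftrightarrow> eventually (\<lambda>i. f i = g i) U"
proof
  assume "uclass U f = uclass U g"
  moreover have "f \<in> uclass U f" by (simp add: uclass_def)
  ultimately show "eventually (\<lambda>i. f i = g i) U" by (simp add: uclass_def)
next
  assume "eventually (\<lambda>i. f i = g i) U"
  then show "uclass U f = uclass U g"
    by (auto simp: uclass_def elim: eventually_elim2)
qed

text \<open>Relations of the ultraproduct are evaluated at chosen representatives; this makes the
  choice harmless.\<close>

lemma uclass_some: "eventually (\<lambda>i. (SOME g. g \<in> uclass U f) i = f i) U"
proof -
  have "f \<in> uclass U f" by (simp add: uclass_def)
  then have "(SOME g. g \<in> uclass U f) \<in> uclass U f" by (rule someI[where P = "\<lambda>g. g \<in> uclass U f"])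
  then show ?thesis by (simp add: uclass_def)
qed

lemma uclass_in_ultraproduct:
  "eventually (\<lambda>i. f i \<in> carrier (N i)) U \<Longrightarrow> uclass U f \<in> carrier (ultraproduct U N)"
  by (auto simp: ultraproduct_def)

text \<open>Induction on the formula. Negation needs the ultrafilter property, and the quantifier
  needs a choice of witnesses along the index set. Membership in the factors is asked of free
  variables only, so that sentences are covered even when some factors are empty.\<close>

theorem Los:
  fixes N :: "'i \<Rightarrow> ('r, 'n) fo_struct"
  assumes U: "ultrafilter U"
  shows "(\<And>j. j \<in> fv p \<Longrightarrow> eventually (\<lambda>i. v j i \<in> carrier (N i)) U) \<Longrightarrow>
    sat (ultraproduct U N) (\<lambda>j. uclass U (v j)) p \<longleftrightarrow>
    eventually (\<lambda>i. sat (N i) (\<lambda>j. v j i) p) U"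
proof (induction p arbitrary: v)
  case (Eq a b)
  then show ?case by (simp add: uclass_eq_iff)
next
  case (Rel r vs)
  \<comment> \<open>A relation symbol has finitely many arguments, so all representatives are
    correct simultaneously at almost every index.\<close>
  have "eventually (\<lambda>i. \<forall>j\<in>set vs. (SOME g. g \<in> uclass U (v j)) i = v j i) U"
    by (intro eventually_ball_finite) (auto intro: uclass_some)
  then have "eventually (\<lambda>i. interp (N i) r (map (\<lambda>j. (SOME g. g \<in> uclass U (v j)) i) vs) \<longleftrightarrow>
      interp (N i) r (map (\<lambda>j. v j i) vs)) U"
    by (rule eventually_mono) (metis (mono_tags, lifting) map_cong)
  then show ?case
    by (simp add: ultraproduct_def comp_def eventually_subst)
next
  case (Neg p)
  then show ?case using ultrafilter_eventually_not[OF U] by simp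
next
  case (And p q)
  then show ?case by (simp add: eventually_conj_iff)
next
  case (Ex n p)
  have IH: "sat (ultraproduct U N) ((\<lambda>j. uclass U (v j))(n := uclass U f)) p \<longleftrightarrow>
      eventually (\<lambda>i. sat (N i) ((\<lambda>j. v j i)(n := f i)) p) U"
    if f: "eventually (\<lambda>i. f i \<in> carrier (N i)) U" for f
  proof -
    \<comment> \<open>Updating commutes both with taking classes and with evaluation at an index, so
      the induction hypothesis applies to \<open>v(n := f)\<close>.\<close>
    have "(\<lambda>j. uclass U (v j))(n := uclass U f) = (\<lambda>j. uclass U ((v(n := f)) j))"
      and "(\<lambda>j. v j i)(n := f i) = (\<lambda>j. (v(n := f)) j i)" for i
      by (simp_all add: fun_eq_iff)
    then show ?thesis
      using Ex.IH[of "v(n := f)"] Ex.prems f by simp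
  qed
  show ?case
  proof
    assume "sat (ultraproduct U N) (\<lambda>j. uclass U (v j)) (Ex n p)"
    then obtain f where f: "eventually (\<lambda>i. f i \<in> carrier (N i)) U"
      and "sat (ultraproduct U N) ((\<lambda>j. uclass U (v j))(n := uclass U f)) p"
      by (auto simp: ultraproduct_def)
    with IH have "eventually (\<lambda>i. sat (N i) ((\<lambda>j. v j i)(n := f i)) p) U" by blast
    with f show "eventually (\<lambda>i. sat (N i) (\<lambda>j. v j i) (Ex n p)) U"
      by (rule eventually_elim2) auto
  next
    assume *: "eventually (\<lambda>i. sat (N i) (\<lambda>j. v j i) (Ex n p)) U"
    \<comment> \<open>A witness wherever one exists, which is almost everywhere; at the other
      indices the value is arbitrary and may lie outside the carrier.\<close>
    define f where
      "f = (\<lambda>i. SOME x. x \<in> carrier (N i) \<and> sat (N i) ((\<lambda>j. v j i)(n := x)) p)"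
    from * have "eventually (\<lambda>i. f i \<in> carrier (N i) \<and> sat (N i) ((\<lambda>j. v j i)(n := f i)) p) U"
    proof (rule eventually_mono)
      fix i assume "sat (N i) (\<lambda>j. v j i) (Ex n p)"
      then have "\<exists>x. x \<in> carrier (N i) \<and> sat (N i) ((\<lambda>j. v j i)(n := x)) p" by auto
      then show "f i \<in> carrier (N i) \<and> sat (N i) ((\<lambda>j. v j i)(n := f i)) p"
        unfolding f_def by (rule someI_ex)
    qed
    then have f: "eventually (\<lambda>i. f i \<in> carrier (N i)) U"
      and "eventually (\<lambda>i. sat (N i) ((\<lambda>j. v j i)(n := f i)) p) U"
      by (simp_all add: eventually_conj_iff)
    then have "sat (ultraproduct U N) ((\<lambda>j. uclass U (v j))(n := uclass U f)) p"
      using IH by blast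
    then show "sat (ultraproduct U N) (\<lambda>j. uclass U (v j)) (Ex n p)"
      using uclass_in_ultraproduct[OF f] by auto
  qed
qed

text \<open>A diagonal embedding in which the map into the factor may vary with the index. By
  elementarity, the truth value in each factor is the one in \<open>M\<close>, so it is constant
  along \<open>U\<close>.\<close>

lemma elementary_embedding_ultraproduct:
  assumes U: "ultrafilter U" and h: "\<And>i. elementary_embedding L M (N i) (h i)"
  shows "elementary_embedding L M (ultraproduct U N) (\<lambda>x. uclass U (\<lambda>i. h i x))"
  unfolding elementary_embedding_def
proof (intro conjI allI impI)
  have hN: "h i x \<in> carrier (N i)" if "x \<in> carrier M" for i x
    using h[of i] that by (auto simp: elementary_embedding_def)
  then show "(\<lambda>x. uclass U (\<lambda>i. h i x)) \<in> carrier M \<rightarrow> carrier (ultraproduct U N)"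
    by (auto intro: uclass_in_ultraproduct)
  fix p v assume pv: "wf_fm L p \<and> v ` fv p \<subseteq> carrier M"
  have "sat (ultraproduct U N) (\<lambda>j. uclass U (\<lambda>i. h i (v j))) p \<longleftrightarrow>
      eventually (\<lambda>i. sat (N i) (\<lambda>j. h i (v j)) p) U"
    using pv hN by (intro Los[OF U]) auto
  also have "\<dots> \<longleftrightarrow> eventually (\<lambda>i. sat M v p) U"
    using h pv by (simp add: elementary_embedding_def comp_def)
  also have "\<dots> \<longleftrightarrow> sat M v p"
    using ultrafilter_neq_bot[OF U] by (simp add: eventually_const)
  finally show "sat M v p \<longleftrightarrow> sat (ultraproduct U N) ((\<lambda>x. uclass U (\<lambda>i. h i x)) \<circ> v) p"
    by (simp add: comp_def)
qed

section \<open>Embeddings and copies\<close>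

lemma embedding_comp:
  assumes "embedding L A B f" "embedding L B C g"
  shows "embedding L A C (g \<circ> f)"
  unfolding embedding_def
proof (intro conjI allI impI)
  have fg: "f \<in> carrier A \<rightarrow> carrier B" "inj_on f (carrier A)"
    "g \<in> carrier B \<rightarrow> carrier C" "inj_on g (carrier B)"
    using assms by (auto simp: embedding_def)
  then show "g \<circ> f \<in> carrier A \<rightarrow> carrier C" by auto
  show "inj_on (g \<circ> f) (carrier A)"
    using fg by (intro comp_inj_on) (auto intro: inj_on_subset)
  fix r as assume ras: "L r = Some (length as) \<and> set as \<subseteq> carrier A"
  then have "set (map f as) \<subseteq> carrier B" using fg by auto
  then show "interp A r as = interp C r (map (g \<circ> f) as)"
    using assms ras unfolding embedding_def by (metis length_map map_map)
qed

lemma isomorphism_comp: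
  "isomorphism L A B f \<Longrightarrow> isomorphism L B C g \<Longrightarrow> isomorphism L A C (g \<circ> f)"
  by (metis isomorphism_def embedding_comp image_comp)

lemma isomorphism_inv_into:
  assumes "isomorphism L A B f"
  shows "isomorphism L B A (inv_into (carrier A) f)"
proof -
  let ?g = "inv_into (carrier A) f"
  have f: "inj_on f (carrier A)" "f ` carrier A = carrier B"
    and emb: "\<And>r as. L r = Some (length as) \<Longrightarrow> set as \<subseteq> carrier A \<Longrightarrow>
      interp A r as \<longleftrightarrow> interp B r (map f as)"
    using assms by (auto simp: isomorphism_def embedding_def)
  have bij: "bij_betw ?g (carrier B) (carrier A)"
    using f by (intro bij_betw_inv_into) (simp add: bij_betw_def)
  have "interp B r bs \<longleftrightarrow> interp A r (map ?g bs)"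
    if "L r = Some (length bs)" "set bs \<subseteq> carrier B" for r bs
  proof -
    have "map f (map ?g bs) = bs"
      using that(2) f(2) by (auto simp: f_inv_into_f subset_iff intro!: map_idI)
    moreover have "set (map ?g bs) \<subseteq> carrier A"
      using that(2) bij by (auto simp: bij_betw_def)
    ultimately show ?thesis using emb[of r "map ?g bs"] that(1) by simp
  qed
  then show ?thesis
    using bij by (auto simp: isomorphism_def embedding_def bij_betw_def)
qed

lemma embedding_substr: "embedding L A (substr M S) f \<Longrightarrow> S \<subseteq> carrier M \<Longrightarrow> embedding L A M f"
  by (auto simp: embedding_def substr_def)

lemma embedding_isomorphism_image:
  assumes "embedding L A B f"
  shows "isomorphism L A (substr B (f ` carrier A)) f"
  using assms by (auto simp: isomorphism_def embedding_def substr_def)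

lemma isomorphism_substr:
  assumes "embedding L M N g" "R \<subseteq> carrier M"
  shows "isomorphism L (substr M R) (substr N (g ` R)) g"
  using assms by (auto simp: isomorphism_def embedding_def substr_def intro: inj_on_subset)

lemma carrier_substr [simp]: "carrier (substr M S) = S"
  by (simp add: substr_def)

lemma substr_substr [simp]: "substr (substr M S) T = substr M T"
  by (simp add: substr_def)

lemma copies_substr:
  "S \<subseteq> carrier M \<Longrightarrow> copies L B (substr M S) = {B' \<in> copies L B M. carrier B' \<subseteq> S}"
  unfolding copies_def by (simp add: set_eq_iff) (metis carrier_substr order_trans)

lemma tuple_copies_substr:
  "S \<subseteq> carrier M \<Longrightarrow> tuple_copies L A as (substr M S) \<subseteq> tuple_copies L A as M"
  by (auto simp: tuple_copies_def intro: embedding_substr)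

text \<open>Embeddings are composed with \<open>g\<close> or with its inverse. The result serves
  both for automorphisms of \<open>M\<close> and for a copy of \<open>B\<close> and its
  image.\<close>

lemma tuple_copies_isomorphism:
  assumes g: "isomorphism L X Y g" and as: "set as \<subseteq> carrier A"
  shows "tuple_copies L A as Y = map g ` tuple_copies L A as X"
proof
  show "map g ` tuple_copies L A as X \<subseteq> tuple_copies L A as Y"
  proof
    fix t assume "t \<in> map g ` tuple_copies L A as X"
    then obtain f where f: "embedding L A X f" "t = map (g \<circ> f) as"
      by (auto simp: tuple_copies_def)
    then have "embedding L A Y (g \<circ> f)"
      using g by (auto simp: isomorphism_def intro: embedding_comp)
    then show "t \<in> tuple_copies L A as Y" 
      using f(2) unfolding tuple_copies_def by blast
  qed
  show "tuple_copies L A as Y \<subseteq> map g ` tuple_copies L A as X"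
  proof
    fix t assume "t \<in> tuple_copies L A as Y"
    then obtain f where f: "embedding L A Y f" "t = map f as"
      by (auto simp: tuple_copies_def)
    let ?h = "inv_into (carrier X) g"
    have "embedding L A X (?h \<circ> f)"
      using f(1) isomorphism_inv_into[OF g] by (auto simp: isomorphism_def intro: embedding_comp)
    moreover have "t = map g (map (?h \<circ> f) as)"
      using f as g
      by (auto simp: isomorphism_def embedding_def intro!: f_inv_into_f[symmetric])
    ultimately show "t \<in> map g ` tuple_copies L A as X"
      unfolding tuple_copies_def by blast
  qed
qed

text \<open>Finiteness turns convergence at each tuple into agreement on all tuples of a finite copy
  at once.\<close>

lemma finite_tuple_copies:
  assumes "finite (carrier B)" "set as \<subseteq> carrier A"
  shows "finite (tuple_copies L A as B)"
proof (rule finite_subset)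
  show "tuple_copies L A as B \<subseteq> {bs. set bs \<subseteq> carrier B \<and> length bs = length as}"
    using assms(2) by (fastforce simp: tuple_copies_def embedding_def)
  show "finite {bs. set bs \<subseteq> carrier B \<and> length bs = length as}"
    by (rule finite_lists_length_eq[OF assms(1)])
qed

text \<open>The structures \<open>C\<close> sought have natural numbers as elements, so a finite
  part of \<open>M\<close> is numbered and its relations are pulled back.\<close>

lemma substr_isomorphic_nat:
  fixes M :: "('r, 'm) fo_struct"
  assumes "finite S"
  obtains C :: "('r, nat) fo_struct" and c where "isomorphism L C (substr M S) c"
proof -
  obtain e :: "'m \<Rightarrow> nat" where e: "inj_on e S"
    using finite_imp_inj_to_nat_seg[OF assms] by blast
  define C :: "('r, nat) fo_struct" where
    "C = \<lparr>carrier = e ` S, interp = (\<lambda>r ns. interp M r (map (inv_into S e) ns))\<rparr>"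
  have "isomorphism L C (substr M S) (inv_into S e)"
    using e by (auto simp: isomorphism_def embedding_def C_def substr_def
        inj_on_inv_into inv_into_into)
  then show ?thesis using that by blast
qed

section \<open>Closure properties of the set of externally definable colourings\<close>

lemma elementary_embedding_comp_isomorphism:
  assumes h: "elementary_embedding L M N h" and g: "isomorphism L M M g"
  shows "elementary_embedding L M N (h \<circ> g)"
  unfolding elementary_embedding_def
proof (intro conjI allI impI)
  have gM: "g ` carrier M = carrier M" using g by (simp add: isomorphism_def)
  then show "h \<circ> g \<in> carrier M \<rightarrow> carrier N"
    using h by (fastforce simp: elementary_embedding_def)
  fix p v assume pv: "wf_fm L p \<and> v ` fv p \<subseteq> carrier M"
  then have "sat M v p \<longleftrightarrow> sat M (g \<circ> v) p"
    using sat_isomorphism[OF g] by blast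
  also have "\<dots> \<longleftrightarrow> sat N (h \<circ> (g \<circ> v)) p"
  proof -
    have "(g \<circ> v) ` fv p \<subseteq> carrier M" using pv gM by auto
    then show ?thesis using h pv unfolding elementary_embedding_def by blast
  qed
  finally show "sat M v p \<longleftrightarrow> sat N (h \<circ> g \<circ> v) p" by (simp add: comp_assoc)
qed

text \<open>The same extension, parameters and formulae define the new colouring once
  \<open>M\<close> is identified with its image through \<open>h \<circ> g\<close> instead of
  \<open>h\<close>. The restriction keeps the colouring extensional.\<close>

lemma ext_colourings_automorphism:
  fixes M :: "('r, 'm) fo_struct"
  assumes g: "isomorphism L M M g" and as: "set as \<subseteq> carrier A"
    and \<chi>: "\<chi> \<in> ext_colourings L M xs ys Phi A as k"
  shows "(\<lambda>t \<in> tuple_copies L A as M. \<chi> (map g t)) \<in> ext_colourings L M xs ys Phi A as k"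
proof -
  let ?T = "tuple_copies L A as M"
  obtain N :: "('r, 'm + nat) fo_struct" and h es \<phi> where
    \<chi>k: "\<chi> \<in> ?T \<rightarrow>\<^sub>E {..<k}" and
    h: "elementary_embedding L M N h" and
    es: "length es = length xs" "set es \<subseteq> carrier N" and
    \<phi>: "\<forall>i<k. \<phi> i \<in> Phi" and
    def: "\<forall>t \<in> ?T. \<forall>i<k. \<chi> t = i \<longleftrightarrow> sat N (assign (xs @ ys) (es @ map h t)) (\<phi> i)"
    using \<chi> unfolding ext_colourings_def ext_colourings_in_def by blast
  have T: "map g t \<in> ?T" if "t \<in> ?T" for t
    using tuple_copies_isomorphism[OF g as] that by blast
  have "(\<lambda>t \<in> ?T. \<chi> (map g t)) \<in> ?T \<rightarrow>\<^sub>E {..<k}"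
    using T \<chi>k by auto
  moreover have "\<forall>t \<in> ?T. \<forall>i<k. (\<lambda>t \<in> ?T. \<chi> (map g t)) t = i \<longleftrightarrow>
      sat N (assign (xs @ ys) (es @ map (h \<circ> g) t)) (\<phi> i)"
    using def T by (auto simp flip: map_map)
  ultimately show ?thesis
    unfolding ext_colourings_def ext_colourings_in_def
    using elementary_embedding_comp_isomorphism[OF h g] es \<phi> by blast
qed

text \<open>A compactness property of the set of definable colourings: the ultraproduct of the
  defining extensions defines the limit, with the classes of the parameters as parameters.\<close>

lemma ext_colourings_ultralimit:
  fixes M :: "('r, 'm) fo_struct" and \<chi> :: "'i \<Rightarrow> 'm list \<Rightarrow> nat"
  assumes U: "ultrafilter U"
    and L: "countable (dom L)"
    and Phi: "\<And>p. p \<in> Phi \<Longrightarrow> wf_fm L p \<and> fv p \<subseteq> set xs \<union> set ys"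
    and finPhi: "finite Phi"
    and len: "length ys = length as"
    and as: "set as \<subseteq> carrier A"
    and \<chi>: "\<And>i. \<chi> i \<in> ext_colourings L M xs ys Phi A as k"
  shows "\<exists>\<chi>' \<in> ext_colourings L M xs ys Phi A as k.
    \<forall>t \<in> tuple_copies L A as M. eventually (\<lambda>i. \<chi> i t = \<chi>' t) U"
proof -
  let ?T = "tuple_copies L A as M"
  have "\<forall>i. \<exists>(N :: ('r, 'm + nat) fo_struct) h es \<phi>.
    elementary_embedding L M N h \<and> length es = length xs \<and> set es \<subseteq> carrier N \<and>
    (\<forall>c<k. \<phi> c \<in> Phi) \<and>
    (\<forall>t \<in> ?T. \<forall>c<k. \<chi> i t = c \<longleftrightarrow> sat N (assign (xs @ ys) (es @ map h t)) (\<phi> c))"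
    using \<chi> unfolding ext_colourings_def ext_colourings_in_def by blast
  then obtain N :: "'i \<Rightarrow> ('r, 'm + nat) fo_struct" and h es \<phi> where
    h: "\<And>i. elementary_embedding L M (N i) (h i)" and
    es: "\<And>i. length (es i) = length xs" "\<And>i. set (es i) \<subseteq> carrier (N i)" and
    \<phi>: "\<And>i c. c < k \<Longrightarrow> \<phi> i c \<in> Phi" and
    def: "\<And>i t c. t \<in> ?T \<Longrightarrow> c < k \<Longrightarrow>
      \<chi> i t = c \<longleftrightarrow> sat (N i) (assign (xs @ ys) (es i @ map (h i) t)) (\<phi> i c)"
    by metis
  have \<chi>k: "\<chi> i t \<in> {..<k}" if "t \<in> ?T" for i t
    using \<chi>[of i] that by (auto simp: ext_colourings_def ext_colourings_in_def)
  have "\<exists>c. c \<in> {..<k} \<and> eventually (\<lambda>i. \<chi> i t = c) U" if "t \<in> ?T" for t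
    using ultrafilter_finite_limit[OF U, of "{..<k}" "\<lambda>i. \<chi> i t"] \<chi>k[OF that] by blast
  then obtain \<chi>0 where \<chi>0: "\<And>t. t \<in> ?T \<Longrightarrow> \<chi>0 t < k"
    "\<And>t. t \<in> ?T \<Longrightarrow> eventually (\<lambda>i. \<chi> i t = \<chi>0 t) U"
    by (metis lessThan_iff)
  \<comment> \<open>The formula defining colour \<open>c\<close> may vary with the index. As
    \<open>Phi\<close> is finite, a single formula is used almost everywhere.\<close>
  have "\<exists>p. p \<in> Phi \<and> eventually (\<lambda>i. \<phi> i c = p) U" if "c < k" for c
    using ultrafilter_finite_limit[OF U finPhi, of "\<lambda>i. \<phi> i c"] \<phi>[OF that] by blast
  then obtain \<psi> where \<psi>: "\<And>c. c < k \<Longrightarrow> \<psi> c \<in> Phi"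
    "\<And>c. c < k \<Longrightarrow> eventually (\<lambda>i. \<phi> i c = \<psi> c) U"
    by metis
  define hu where "hu = (\<lambda>x. uclass U (\<lambda>i. h i x))"
  define eu where "eu = map (\<lambda>n. uclass U (\<lambda>i. es i ! n)) [0..<length xs]"
  define \<chi>' where "\<chi>' = restrict \<chi>0 ?T"
  have key: "\<chi>' t = c \<longleftrightarrow>
      sat (ultraproduct U N) (assign (xs @ ys) (eu @ map hu t)) (\<psi> c)"
    if t: "t \<in> ?T" and c: "c < k" for t c
  proof -
    have lt: "length t = length ys" and tM: "set t \<subseteq> carrier M"
      using t len as by (auto simp: tuple_copies_def embedding_def Pi_iff subset_iff)
    let ?v = "\<lambda>i. assign (xs @ ys) (es i @ map (h i) t)"
    have le: "length (xs @ ys) = length (es i @ map (h i) t)" for i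
      using lt es(1) by simp
    have fv: "fv (\<psi> c) \<subseteq> set (xs @ ys)" using Phi \<psi>(1)[OF c] by auto
    \<comment> \<open>The values of the variables as functions of the index: evaluation at
      \<open>i\<close> gives the tuple used in \<open>N i\<close>, and passing to classes gives the
      tuple used in the ultraproduct.\<close>
    define ps where "ps = map (\<lambda>n i. es i ! n) [0..<length xs] @ map (\<lambda>x i. h i x) t"
    have lps: "length (xs @ ys) = length ps" by (simp add: ps_def lt)
    have ps_eval: "map (\<lambda>f. f i) ps = es i @ map (h i) t" for i
      using es(1)[of i] by (simp add: ps_def comp_def) (metis map_nth)
    have v: "?v i j = assign (xs @ ys) ps j i" if "j \<in> set (xs @ ys)" for i j
      using assign_map[OF lps that, of "\<lambda>f. f i"] ps_eval[of i] by simp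
    have ps_class: "map (uclass U) ps = eu @ map hu t"
      by (simp add: ps_def eu_def hu_def comp_def)
    have "sat (ultraproduct U N) (assign (xs @ ys) (eu @ map hu t)) (\<psi> c) \<longleftrightarrow>
        sat (ultraproduct U N) (\<lambda>j. uclass U (assign (xs @ ys) ps j)) (\<psi> c)"
      using assign_map[OF lps, of _ "uclass U"] fv
      unfolding ps_class by (intro sat_cong) blast
    also have "\<dots> \<longleftrightarrow> eventually (\<lambda>i. sat (N i) (\<lambda>j. assign (xs @ ys) ps j i) (\<psi> c)) U"
    proof (rule Los[OF U])
      fix j assume "j \<in> fv (\<psi> c)"
      then have j: "j \<in> set (xs @ ys)" using fv by blast
      have "set (es i @ map (h i) t) \<subseteq> carrier (N i)" for i
        using es(2)[of i] h[of i] tM by (auto simp: elementary_embedding_def)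
      then have "assign (xs @ ys) ps j i \<in> carrier (N i)" for i
        using assign_in[OF le j, of i] v[OF j, of i] by auto
      then show "eventually (\<lambda>i. assign (xs @ ys) ps j i \<in> carrier (N i)) U" by simp
    qed
    also have "\<dots> \<longleftrightarrow> eventually (\<lambda>i. sat (N i) (?v i) (\<psi> c)) U"
    proof -
      have "sat (N i) (\<lambda>j. assign (xs @ ys) ps j i) (\<psi> c) \<longleftrightarrow> sat (N i) (?v i) (\<psi> c)" for i
        using v fv by (intro sat_cong) (metis subsetD)
      then show ?thesis by simp
    qed
    also have "\<dots> \<longleftrightarrow> eventually (\<lambda>i. \<chi>' t = c) U"
    proof (rule eventually_subst)
      \<comment> \<open>At almost every index the formula for \<open>c\<close> is
        \<open>\<psi> c\<close> and the colour of \<open>t\<close> is its limit, so the definition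
        of \<open>\<chi> i\<close> decides the matter.\<close>
      show "eventually (\<lambda>i. sat (N i) (?v i) (\<psi> c) \<longleftrightarrow> \<chi>' t = c) U"
        using \<psi>(2)[OF c] \<chi>0(2)[OF t]
      proof eventually_elim
        case (elim i)
        then show ?case using def[OF t c, of i] t by (simp add: \<chi>'_def)
      qed
    qed
    also have "\<dots> \<longleftrightarrow> \<chi>' t = c"
      using ultrafilter_neq_bot[OF U] by (simp add: eventually_const)
    finally show ?thesis ..
  qed
  have eu: "length eu = length xs" "set eu \<subseteq> carrier (ultraproduct U N)"
    using es by (auto simp: eu_def subset_iff intro!: uclass_in_ultraproduct)
  have "\<chi>' \<in> ?T \<rightarrow>\<^sub>E {..<k}" using \<chi>0(1) by (auto simp: \<chi>'_def)
  then have "\<chi>' \<in> ext_colourings_in TYPE(('i \<Rightarrow> 'm + nat) set) L M xs ys Phi A as k"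
    unfolding ext_colourings_in_def
    by (intro CollectI conjI exI[of _ "ultraproduct U N"] exI[of _ hu] exI[of _ eu] exI[of _ \<psi>])
      (use elementary_embedding_ultraproduct[of U L M N h, OF U h] eu \<psi>(1) key in
        \<open>simp_all add: hu_def[symmetric]\<close>)
  \<comment> \<open>The elements of the ultraproduct are sets of functions; the downward
    Loewenheim-Skolem argument returns to the fixed universe.\<close>
  then have "\<chi>' \<in> ext_colourings L M xs ys Phi A as k"
    using ext_colourings_universal[OF L Phi len as] by blast
  moreover have "eventually (\<lambda>i. \<chi> i t = \<chi>' t) U" if "t \<in> ?T" for t
    using \<chi>0(2)[OF that] that by (simp add: \<chi>'_def)
  ultimately show ?thesis by blast
qed

section \<open>The arrow relations\<close>

text \<open>One copy of \<open>C\<close> in \<open>M\<close> suffices: every copy of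
  \<open>B\<close> inside it is a copy of \<open>B\<close> in \<open>M\<close>.\<close>

lemma ext_arrow_age_imp_structure:
  assumes C: "C \<in> Age L M" and arrow: "ext_arrow_age L M xs ys Phi C B A as k"
  shows "ext_arrow_structure L M xs ys Phi B A as k"
proof -
  obtain f where f: "embedding L C M f" using C by (auto simp: Age_def)
  let ?S = "f ` carrier C"
  have S: "?S \<subseteq> carrier M" using f by (auto simp: embedding_def)
  then have "substr M ?S \<in> copies L C M"
    using embedding_isomorphism_image[OF f] by (auto simp: copies_def)
  then show ?thesis
    using arrow copies_substr[OF S, of L B]
    unfolding ext_arrow_structure_def ext_arrow_age_def by blast
qed

text \<open>Failure of the arrow for a structure isomorphic to \<open>S\<close> only gives a
  colouring that is bad on some copy \<open>T\<close>. Ultrahomogeneity extends an isomorphism from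
  \<open>S\<close> to \<open>T\<close> to an automorphism, along which the colouring is pulled
  back.\<close>

lemma finite_bad_colouring:
  fixes M :: "('r, 'm) fo_struct"
  assumes M: "ultrahomogeneous L M" and as: "set as \<subseteq> carrier A"
    and S: "finite S" "S \<subseteq> carrier M"
    and none: "\<And>C :: ('r, nat) fo_struct. C \<in> Age L M \<Longrightarrow> \<not> ext_arrow_age L M xs ys Phi C B A as k"
  obtains \<chi> where "\<chi> \<in> ext_colourings L M xs ys Phi A as k"
    "\<And>B'. B' \<in> copies L B M \<Longrightarrow> carrier B' \<subseteq> S \<Longrightarrow> \<not> monochromatic \<chi> (tuple_copies L A as B')"
proof -
  obtain C :: "('r, nat) fo_struct" and c where c: "isomorphism L C (substr M S) c"
    using substr_isomorphic_nat[OF S(1)] by blast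
  have "finite (carrier C)"
    using c S(1) finite_imageD[of c "carrier C"] by (auto simp: isomorphism_def embedding_def)
  then have "C \<in> Age L M"
    using c S(2) by (auto simp: Age_def isomorphism_def intro: embedding_substr)
  then have "\<not> ext_arrow_age L M xs ys Phi C B A as k" by (rule none)
  then obtain T t \<chi> where T: "T \<subseteq> carrier M" and t: "isomorphism L C (substr M T) t"
    and \<chi>: "\<chi> \<in> ext_colourings L M xs ys Phi A as k"
    and bad: "\<And>B'. B' \<in> copies L B (substr M T) \<Longrightarrow> \<not> monochromatic \<chi> (tuple_copies L A as B')"
    unfolding ext_arrow_age_def copies_def[of L C M] by blast
  define u where "u = t \<circ> inv_into (carrier C) c"
  have u: "isomorphism L (substr M S) (substr M T) u"
    unfolding u_def by (rule isomorphism_comp[OF isomorphism_inv_into[OF c] t])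
  then have uS: "u ` S = T" by (simp add: isomorphism_def)
  then obtain g where g: "isomorphism L M M g" and gu: "\<forall>x\<in>S. g x = u x"
    using M u S T unfolding ultrahomogeneous_def by (metis finite_imageI)
  have gS: "g ` S = T" using gu uS by (metis image_cong)
  show ?thesis
  proof
    show "(\<lambda>t \<in> tuple_copies L A as M. \<chi> (map g t)) \<in> ext_colourings L M xs ys Phi A as k"
      by (rule ext_colourings_automorphism[OF g as \<chi>])
    fix B' assume B': "B' \<in> copies L B M" "carrier B' \<subseteq> S"
    then obtain R b where R: "B' = substr M R" "R \<subseteq> carrier M" "R \<subseteq> S"
      and b: "isomorphism L B (substr M R) b"
      by (auto simp: copies_def)
    have gR: "isomorphism L (substr M R) (substr M (g ` R)) g"
      using g R(2) by (auto simp: isomorphism_def[of L M M] intro: isomorphism_substr)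
    \<comment> \<open>A copy of \<open>B\<close> inside \<open>S\<close> is moved to one inside
      \<open>T\<close>, where \<open>\<chi>\<close> is known to be bad.\<close>
    have "substr M (g ` R) \<in> copies L B (substr M T)"
      using isomorphism_comp[OF b gR] R(3) gS by (auto simp: copies_def)
    then have "\<not> monochromatic \<chi> (map g ` tuple_copies L A as B')"
      using bad tuple_copies_isomorphism[OF gR as] R(1) by metis
    then show "\<not> monochromatic (\<lambda>t \<in> tuple_copies L A as M. \<chi> (map g t)) (tuple_copies L A as B')"
      using tuple_copies_substr[OF R(2), of L A as] R(1)
      by (auto simp: monochromatic_def subset_iff)
  qed
qed

lemma ext_arrow_structure_imp_age:
  fixes M :: "('r, 'm) fo_struct"
  assumes L: "countable (dom L)"
    and M: "ultrahomogeneous L M"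
    and as: "set as \<subseteq> carrier A"
    and B: "finite (carrier B)"
    and len: "length ys = length as"
    and finPhi: "finite Phi"
    and Phi: "\<And>p. p \<in> Phi \<Longrightarrow> wf_fm L p \<and> fv p \<subseteq> set xs \<union> set ys"
    and arrow: "ext_arrow_structure L M xs ys Phi B A as k"
  obtains C :: "('r, nat) fo_struct"
  where "C \<in> Age L M" "ext_arrow_age L M xs ys Phi C B A as k"
proof (rule ccontr)
  let ?\<Gamma> = "ext_colourings L M xs ys Phi A as k"
  assume "\<not> thesis"
  with that have none: "\<not> ext_arrow_age L M xs ys Phi C B A as k"
    if "C \<in> Age L M" for C :: "('r, nat) fo_struct"
    using that by blast
  note bad = finite_bad_colouring[OF M as _ _ none]
  \<comment> \<open>The index type consists of all sets, so a colouring is needed for every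
    \<open>S\<close>; outside the finite subsets of \<open>M\<close>, the one obtained for the empty
    set is the default.\<close>
  have "\<exists>\<chi>. \<chi> \<in> ?\<Gamma> \<and> (finite S \<and> S \<subseteq> carrier M \<longrightarrow> (\<forall>B' \<in> copies L B M.
      carrier B' \<subseteq> S \<longrightarrow> \<not> monochromatic \<chi> (tuple_copies L A as B')))" for S
  proof (cases "finite S \<and> S \<subseteq> carrier M")
    case True
    then show ?thesis using bad[of S] by metis
  next
    case False
    then show ?thesis using bad[of "{}"] by (metis finite.emptyI empty_subsetI)
  qed
  then obtain \<chi> where \<chi>: "\<And>S. \<chi> S \<in> ?\<Gamma>"
    and \<chi>_bad: "\<And>S B'. finite S \<Longrightarrow> S \<subseteq> carrier M \<Longrightarrow> B' \<in> copies L B M \<Longrightarrow> carrier B' \<subseteq> S \<Longrightarrow>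
      \<not> monochromatic (\<chi> S) (tuple_copies L A as B')"
    by metis
  obtain U where U: "ultrafilter U" "U \<le> finite_subsets_at_top (carrier M)"
    using ex_ultrafilter[OF finite_subsets_at_top_neq_bot] by blast
  obtain \<chi>' where \<chi>': "\<chi>' \<in> ?\<Gamma>"
    and lim: "\<And>t. t \<in> tuple_copies L A as M \<Longrightarrow> eventually (\<lambda>S. \<chi> S t = \<chi>' t) U"
    using ext_colourings_ultralimit[where \<chi> = \<chi>, OF U(1) L Phi finPhi len as \<chi>] by metis
  obtain B' where B': "B' \<in> copies L B M" and mono: "monochromatic \<chi>' (tuple_copies L A as B')"
    using arrow \<chi>' unfolding ext_arrow_structure_def by blast
  obtain R where R: "B' = substr M R" "R \<subseteq> carrier M" "finite R"
    using B' B by (auto simp: copies_def isomorphism_def)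
  let ?T = "tuple_copies L A as B'"
  have "\<forall>t\<in>?T. eventually (\<lambda>S. \<chi> S t = \<chi>' t) U"
    using lim tuple_copies_substr[OF R(2), of L A as] R(1) by blast
  then have "eventually (\<lambda>S. \<forall>t\<in>?T. \<chi> S t = \<chi>' t) U"
    using finite_tuple_copies[OF _ as, of B' L] R(1,3) by (intro eventually_ball_finite) auto
  moreover have "eventually (\<lambda>S. finite S \<and> R \<subseteq> S \<and> S \<subseteq> carrier M) U"
    by (rule filter_leD[OF U(2)])
      (use R(2,3) in \<open>auto simp: eventually_finite_subsets_at_top intro!: exI[of _ R]\<close>)
  \<comment> \<open>At a single index \<open>S\<close> containing \<open>R\<close>, the colouring
    \<open>\<chi> S\<close> agrees with the limit on all tuples of \<open>B'\<close>, hence is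
    monochromatic there, contrary to its choice.\<close>
  ultimately have "eventually (\<lambda>S. False) U"
  proof eventually_elim
    case (elim S)
    then have "monochromatic (\<chi> S) ?T" using mono unfolding monochromatic_def by metis
    then show False using \<chi>_bad[of S B'] B' elim R(1) by simp
  qed
  then show False using ultrafilter_neq_bot[OF U(1)] by (simp add: trivial_limit_def)
qed

theorem proposition3p6:
  fixes L :: "'r language"
    and M :: "('r, 'm) fo_struct"
    and A :: "('r, 'a) fo_struct" and as :: "'a list"
    and B :: "('r, 'b) fo_struct"
    and k :: nat
    and xs ys :: "nat list" and Phi :: "'r fm set"
  assumes "countable (dom L)"
    and "ultrahomogeneous L M"
    and "A \<in> Age L M" and "enumerates as A"
    and "B \<in> Age L M"
    and "k \<ge> 1"
    and "distinct (xs @ ys)" and "length ys = length as"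
    and "finite Phi"
    and "\<And>p. p \<in> Phi \<Longrightarrow> wf_fm L p \<and> fv p \<subseteq> set xs \<union> set ys"
  shows "ext_arrow_structure L M xs ys Phi B A as k \<longleftrightarrow>
    (\<exists>C \<in> (Age L M :: ('r, nat) fo_struct set). ext_arrow_age L M xs ys Phi C B A as k)"
proof
  have as: "set as \<subseteq> carrier A" using assms(4) by (simp add: enumerates_def)
  have B: "finite (carrier B)" using assms(5) by (simp add: Age_def)
  assume "ext_arrow_structure L M xs ys Phi B A as k"
  then show "\<exists>C \<in> (Age L M :: ('r, nat) fo_struct set). ext_arrow_age L M xs ys Phi C B A as k"
    using ext_arrow_structure_imp_age[OF assms(1,2) as B assms(8,9,10)] by blast
next
  assume "\<exists>C \<in> (Age L M :: ('r, nat) fo_struct set). ext_arrow_age L M xs ys Phi C B A as k"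
  then show "ext_arrow_structure L M xs ys Phi B A as k"
    using ext_arrow_age_imp_structure by blast
qed

end
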